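(* Let $R\ge1$ be an integer and $f:\mathbb{R}^m\to\mathbb{R}^m$. The approximate Lax-Wendroff-type scheme (defined in the context) $$u_i^{n+1}=u_i^n+\sum_{l=1}^{R}\frac{(\Delta t)^l}{l!}\,\widetilde u^{(l)}_{i,n}$$ for the one-dimensional system $u_t+f(u)_x=0$ can be written in conservation form, namely, there are numerical fluxes $\hat g^n_{i+\frac12}$ such that $$u_i^{n+1}=u_i^n-\frac{\Delta t}{h}\big(\hat g^n_{i+\frac12}-\hat g^n_{i-\frac12}\big)\qquad\text{for all } i.$$
   Context: Conservation form: as usual, the numerical fluxes have the form $\hat g^n_{i+\frac12}=\hat g(u^n_{i-K},\dots,u^n_{i+K})$ for some integer $K\ge0$ and a single function $\hat g$ not depending on $i$ or $n$ (it may depend on $f$, $R$, $h$ and $\Delta t$). Grid: $x_i$, $i\in\mathbb{Z}$, is a uniform spatial grid with spacing $h=x_{i+1}-x_i>0$; $\delta=\Delta t=t_{n+1}-t_n>0$. Boundary effects are ignored ($i$ ranges over $\mathbb{Z}$). Grid functions: for $w:\mathbb{R}\to\mathbb{R}^m$, a base point $a$ and a spacing $h>0$, $G_{a,h}(w):\mathbb{Z}\to\mathbb{R}^m$ is $G_{a,h}(w)_i=w(a+ih)$. Centered difference operators: for integers $p,q\ge 1$ let $s=\lfloor\frac{p-1}{2}\rfloor+q$ and, for $v:\mathbb{Z}\to\mathbb{R}^m$, $$\Delta^{p,q}_h v=\frac{1}{h^p}\sum_{l=-s}^{s}\beta_l^{p,q}v_l,$$ where $(\beta_l^{p,q})_{l=-s}^{s}$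 is the unique solution of the linear system $\sum_{l=-s}^{s}\beta_l^{p,q}l^{j}=0$ for $j=0,\dots,2s$, $j\ne p$, and $\sum_{l=-s}^{s}\beta_l^{p,q}l^{p}=p!$ (with $0^0=1$). WENO numerical fluxes: put $r=\lceil\frac{R+1}{2}\rceil$. The values $\hat f^n_{i+\frac12}=\hat f(u^n_{i-r+1},\dots,u^n_{i+r})$ are given by a numerical flux function $\hat f:(\mathbb{R}^m)^{2r}\to\mathbb{R}^m$ (that of the Shu-Osher finite difference scheme with upwind WENO reconstructions of order $2r-1$ applied to split fluxes). Scheme: given data $u_i^n$, $i\in\mathbb{Z}$, at time $t_n$, set $$\widetilde u^{(0)}_{i,n}=u_i^n,\qquad \widetilde u^{(1)}_{i,n}=-\frac{\hat f^n_{i+\frac12}-\hat f^n_{i-\frac12}}{h}.$$ For $k\ge 1$, once $\widetilde u^{(l)}_{i,n}$, $0\le l\le k$, are known, define the polynomial $T_k[h,i,n](\rho)=\sum_{l=0}^{k}\frac{\widetilde u^{(l)}_{i,n}}{l!}\rho^l$. Then recursively for $k=1,\dots,R-1$ define, for all $i$, $$\widetilde f^{(k)}_{i,n}=\Delta_\delta^{k,\lceil\frac{R-k}{2}\rceil}\Big(G_{0,\delta}\big(f(T_k[h,i,n])\big)\Big),\qquad \widetilde u^{(k+1)}_{i,n}=-\Delta_h^{1,\lceil\frac{R-k}{2}\rceil}\,\widetilde f^{(k)}_{i+\cdot,n},$$ where $f(T_k[h,i,n])$ is the function $\rho\mapsto f(T_k[h,i,n](\rho))$ and $\widetilde f^{(k)}_{i+\cdot,n}$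 is the grid function $j\mapsto\widetilde f^{(k)}_{i+j,n}$. The new values are $u_i^{n+1}=u_i^n+\sum_{l=1}^{R}\frac{(\Delta t)^l}{l!}\widetilde u^{(l)}_{i,n}$. *)

theory Defs
  imports "HOL-Analysis.Analysis" "HOL-Computational_Algebra.Polynomial"
begin

text \<open>
  Grid functions are maps \<open>int \<Rightarrow> 'a\<close>. The state space \<open>\<real>\<^sup>m\<close> is an arbitrary real vector space
  \<open>'a\<close> in the definitions and \<open>real ^ 'm\<close> in the theorem.
\<close>

definition grid :: "real \<Rightarrow> real \<Rightarrow> (real \<Rightarrow> 'a) \<Rightarrow> int \<Rightarrow> 'a" where
  "grid a h w i = w (a + of_int i * h)"

definition fd_radius :: "nat \<Rightarrow> nat \<Rightarrow> nat" where
  "fd_radius p q = (p - 1) div 2 + q"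

text \<open>
  The linear system for the centered difference weights; \<open>\<beta>\<close> is extended by \<open>0\<close> outside
  \<open>{-s..s}\<close>, so that its solution is unique as a function on \<open>int\<close>. Note \<open>0 ^ 0 = 1\<close>.
\<close>

definition fd_system :: "nat \<Rightarrow> nat \<Rightarrow> (int \<Rightarrow> real) \<Rightarrow> bool" where
  "fd_system p q \<beta> \<longleftrightarrow>
     (let s = fd_radius p q in
       (\<forall>j \<in> {0..2 * s} - {p}. (\<Sum>l = - int s..int s. \<beta> l * of_int l ^ j) = 0) \<and>
       (\<Sum>l = - int s..int s. \<beta> l * of_int l ^ p) = fact p \<and>
       (\<forall>l. l \<notin> {- int s..int s} \<longrightarrow> \<beta> l = 0))"

definition fd_coeff :: "nat \<Rightarrow> nat \<Rightarrow> int \<Rightarrow> real" where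
  "fd_coeff p q = (THE \<beta>. fd_system p q \<beta>)"

definition fd_diff :: "real \<Rightarrow> nat \<Rightarrow> nat \<Rightarrow> (int \<Rightarrow> 'a::real_vector) \<Rightarrow> 'a" where
  "fd_diff h p q v =
     (1 / h ^ p) *\<^sub>R (\<Sum>l = - int (fd_radius p q)..int (fd_radius p q). fd_coeff p q l *\<^sub>R v l)"

lemma fd_system_unique_existence:
  assumes "p \<ge> 1" and "q \<ge> 1"
  shows "\<exists>!\<beta>. fd_system p q \<beta>"
proof -
  define s where "s = fd_radius p q"
  define A where "A = {- int s..int s}"
  define N where "N l = (\<Prod>k\<in>A - {l}. [:- real_of_int k, 1:])" for l
  define L where "L l = smult (1 / poly (N l) (of_int l)) (N l)" for l
  have finA: "finite A" and cardA: "card A = 2 * s + 1"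
    by (auto simp: A_def)
  have p_le: "p \<le> 2 * s"
    using assms by (auto simp: s_def fd_radius_def)
  have N_at: "poly (N l) (of_int k) = (\<Prod>j\<in>A - {l}. of_int k - of_int j)" for l k
    by (simp add: N_def poly_prod)
  have N_nz: "poly (N l) (of_int l) \<noteq> 0" for l
    by (simp add: N_at finA)
  have N_z: "poly (N l) (of_int k) = 0" if "k \<in> A" "k \<noteq> l" for l k
    using that finA by (auto simp: N_at)
  have deg_N: "degree (N l) \<le> 2 * s" if "l \<in> A" for l
  proof -
    have "degree (N l) \<le> (\<Sum>k\<in>A - {l}. degree [:- real_of_int k, 1:])"
      unfolding N_def using degree_prod_sum_le[of "A - {l}" "\<lambda>k. [:- real_of_int k, 1:]"] finA by (simp add: o_def)
    also have "\<dots> = 2 * s"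
      using that finA cardA by simp
    finally show ?thesis .
  qed
  have L_at: "poly (L l) (of_int k) = (if k = l then 1 else 0)" if "k \<in> A" for l k
    using that N_nz N_z by (auto simp: L_def)
  have deg_L: "degree (L l) \<le> 2 * s" if "l \<in> A" for l
    using deg_N[OF that] by (simp add: L_def)
  have interpol: "(\<Sum>l\<in>A. smult (of_int l ^ j) (L l)) = monom 1 j" if "j \<le> 2 * s" for j
  proof (rule ccontr)
    define P where "P = (\<Sum>l\<in>A. smult (real_of_int l ^ j) (L l)) - monom 1 j"
    assume "(\<Sum>l\<in>A. smult (of_int l ^ j) (L l)) \<noteq> monom 1 j"
    then have nz: "P \<noteq> 0" by (simp add: P_def)
    have roots: "poly P (of_int k) = 0" if "k \<in> A" for k
    proof -
      have "poly P (of_int k) =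
          (\<Sum>l\<in>A. real_of_int l ^ j * (if k = l then 1 else 0)) - of_int k ^ j"
        using that by (simp add: P_def poly_sum L_at poly_monom)
      also have "\<dots> = 0" using finA that by (simp add: if_distrib sum.delta cong: if_cong)
      finally show ?thesis .
    qed
    have "degree P \<le> 2 * s"
      unfolding P_def using that deg_L
      by (intro degree_diff_le degree_sum_le finA)
         (auto intro: order.trans[OF degree_smult_le] order.trans[OF degree_monom_le])
    moreover have "card (of_int ` A :: real set) \<le> card {x. poly P x = 0}"
      using roots by (intro card_mono poly_roots_finite nz) auto
    moreover have "card (of_int ` A :: real set) = 2 * s + 1"
      using cardA by (subst card_image) (auto simp: inj_on_def)
    moreover have "card {x. poly P x = 0} \<le> degree P"
      by (rule card_poly_roots_bound[OF nz])
    ultimately show False by linarith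
  qed
  define \<beta> where "\<beta> l = (if l \<in> A then fact p * coeff (L l) p else 0)" for l
  have moment: "(\<Sum>l\<in>A. \<beta> l * of_int l ^ j) = (if j = p then fact p else 0)"
    if "j \<le> 2 * s" for j
  proof -
    have "(\<Sum>l\<in>A. \<beta> l * of_int l ^ j) = fact p * (\<Sum>l\<in>A. of_int l ^ j * coeff (L l) p)"
      by (simp add: \<beta>_def sum_distrib_left mult_ac)
    also have "(\<Sum>l\<in>A. of_int l ^ j * coeff (L l) p) = coeff (monom 1 j) p"
      unfolding interpol[OF that, symmetric] by (simp add: coeff_sum)
    finally show ?thesis by simp
  qed
  have ex: "fd_system p q \<beta>"
    using moment p_le unfolding fd_system_def Let_def s_def[symmetric] A_def[symmetric]
    by (auto simp: \<beta>_def)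
  show ?thesis
  proof (rule ex1I[of "fd_system p q", OF ex])
    fix \<gamma> assume \<gamma>: "fd_system p q \<gamma>"
    define d where "d l = \<gamma> l - \<beta> l" for l
    have mom: "(\<Sum>l\<in>A. d l * of_int l ^ j) = 0" if "j \<le> 2 * s" for j
      using \<gamma> ex that unfolding fd_system_def Let_def s_def[symmetric] A_def[symmetric] d_def
      by (cases "j = p") (auto simp: left_diff_distrib sum_subtractf)
    have "d k = 0" if k: "k \<in> A" for k
    proof -
      have "(\<Sum>l\<in>A. d l * poly (N k) (of_int l)) =
          (\<Sum>l\<in>A. \<Sum>j\<le>degree (N k). coeff (N k) j * (d l * of_int l ^ j))"
        by (simp add: poly_altdef sum_distrib_left mult_ac)
      also have "\<dots> = (\<Sum>j\<le>degree (N k). coeff (N k) j * (\<Sum>l\<in>A. d l * of_int l ^ j))"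
        by (subst sum.swap) (simp add: sum_distrib_left)
      also have "\<dots> = 0"
        using mom deg_N[OF k] by (intro sum.neutral) auto
      also have "(\<Sum>l\<in>A. d l * poly (N k) (of_int l)) = d k * poly (N k) (of_int k)"
        using k finA N_z by (subst sum.remove[of _ k]) (auto intro!: sum.neutral)
      finally show ?thesis using N_nz by simp
    qed
    moreover have "d k = 0" if "k \<notin> A" for k
      using \<gamma> ex that unfolding fd_system_def Let_def s_def[symmetric] A_def[symmetric] d_def
      by auto
    ultimately show "\<gamma> = \<beta>" by (auto simp: d_def fun_eq_iff)
  qed
qed

text \<open>
  A function of finitely many consecutive grid values takes the list of these values as argument:
  \<open>stencil v a b\<close> is \<open>[v a, v (a + 1), \<dots>, v b]\<close>.
\<close>

definition stencil :: "(int \<Rightarrow> 'a) \<Rightarrow> int \<Rightarrow> int \<Rightarrow> 'a list" where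
  "stencil v a b = map v [a..b]"

text \<open>
  The scheme with parameters \<open>R\<close>, flux \<open>f\<close>, grid sizes \<open>h\<close>, \<open>\<delta>\<close>, for data \<open>v\<close> at the current time.
  The WENO flux enters as an arbitrary numerical flux function \<open>fhat\<close> of \<open>2 r\<close> grid values;
  \<open>weno_flux i\<close> is its value at the cell interface \<open>i + 1/2\<close>.
\<close>

context
  fixes R :: nat
    and f :: "'a::real_vector \<Rightarrow> 'a"
    and fhat :: "'a list \<Rightarrow> 'a"
    and h \<delta> :: real
    and v :: "int \<Rightarrow> 'a"
begin

definition weno_flux :: "int \<Rightarrow> 'a" where
  "weno_flux i = (let r = \<lceil>(real R + 1) / 2\<rceil> in fhat (stencil v (i - r + 1) (i + r)))"

function u_tilde :: "nat \<Rightarrow> int \<Rightarrow> 'a" and f_tilde :: "nat \<Rightarrow> int \<Rightarrow> 'a" where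
  "u_tilde 0 i = v i"
| "u_tilde (Suc 0) i = - ((1 / h) *\<^sub>R (weno_flux i - weno_flux (i - 1)))"
| "u_tilde (Suc (Suc k)) i =
     - fd_diff h 1 (nat \<lceil>(real R - real (Suc k)) / 2\<rceil>) (\<lambda>j. f_tilde (Suc k) (i + j))"
| "f_tilde k i =
     fd_diff \<delta> k (nat \<lceil>(real R - real k) / 2\<rceil>)
       (grid 0 \<delta> (\<lambda>\<rho>. f (\<Sum>l\<le>k. (\<rho> ^ l / fact l) *\<^sub>R u_tilde l i)))"
  by pat_completeness auto
termination
  by (relation "Wellfounded.measure (case_sum (\<lambda>(k, i). 2 * k) (\<lambda>(k, i). 2 * k + 1))") auto

definition lw_step :: "int \<Rightarrow> 'a" where
  "lw_step i = v i + (\<Sum>l = 1..R. (\<delta> ^ l / fact l) *\<^sub>R u_tilde l i)"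

end

end

theory Submission
  imports Defs
begin

text \<open>
  Two observations carry the proof. First, the weights of every centered difference operator sum
  to zero (the moment condition of order \<open>0\<close>). Hence applying the operator to a grid function \<open>w\<close>
  annihilates constants, and by summation by parts the result is a backward difference
  \<open>G i - G (i - 1)\<close> of a fixed linear combination \<open>G\<close> of shifts of \<open>w\<close>
  (\<open>fd_diff_conservative\<close>). Each correction \<open>u_tilde l\<close> of the scheme, \<open>l \<ge> 1\<close>, is such a spatial
  difference, of the WENO flux for \<open>l = 1\<close> and of \<open>f_tilde (l - 1)\<close> otherwise, so it equals
  \<open>- (1 / h) * (\<Phi> i - \<Phi> (i - 1))\<close> for an explicit \<open>\<Phi> = correction_flux l\<close>. Weighting these by
  \<open>\<delta> ^ (l - 1) / l!\<close> gives the total flux.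

  Second, conservation form also asks that this flux be one function of \<open>2 K + 1\<close> neighbouring
  values, the same at all positions and times. An operator on grid functions has this form
  exactly when it cannot distinguish two positions, even in different grid functions, whose
  surroundings up to a fixed distance agree (\<open>translation_local\<close>). That property passes to
  shifts and to any combination of finitely many operators at a point, and the scheme is built
  from the data by these two operations, so it propagates through the mutual recursion of
  \<open>u_tilde\<close> and \<open>f_tilde\<close>.
\<close>

section \<open>Translation-invariant local operators\<close>

text \<open>
  Comparing different grid functions at different positions expresses locality and translation
  invariance in a single condition, which is preserved more easily by the scheme's operations
  than an explicit representation by a stencil function.
\<close>

definition translation_local :: "((int \<Rightarrow> 'a) \<Rightarrow> int \<Rightarrow> 'b) \<Rightarrow> bool" where
  "translation_local \<Phi> \<longleftrightarrow>
     (\<exists>K :: nat. \<forall>v w i j. (\<forall>d \<in> {- int K..int K}. v (i + d) = w (j + d)) \<longrightarrow> \<Phi> v i = \<Phi> w j)"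

lemma translation_local_eval: "translation_local (\<lambda>v i. v i)"
  unfolding translation_local_def by (rule exI[of _ 0]) simp

lemma translation_local_shift:
  assumes "translation_local \<Phi>"
  shows "translation_local (\<lambda>v i. \<Phi> v (i + c))"
proof -
  obtain K :: nat where K: "\<And>v w i j. (\<forall>d \<in> {- int K..int K}. v (i + d) = w (j + d)) \<Longrightarrow> \<Phi> v i = \<Phi> w j"
    using assms unfolding translation_local_def by blast
  show ?thesis
    unfolding translation_local_def
  proof (intro exI[of _ "K + nat \<bar>c\<bar>"] allI impI)
    fix v w :: "int \<Rightarrow> 'a" and i j :: int
    assume eq: "\<forall>d \<in> {- int (K + nat \<bar>c\<bar>)..int (K + nat \<bar>c\<bar>)}. v (i + d) = w (j + d)"
    show "\<Phi> v (i + c) = \<Phi> w (j + c)"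
    proof (rule K, intro ballI)
      fix d assume "d \<in> {- int K..int K}"
      then have "c + d \<in> {- int (K + nat \<bar>c\<bar>)..int (K + nat \<bar>c\<bar>)}"
        by auto
      from bspec[OF eq this] show "v (i + c + d) = w (j + c + d)"
        by (simp only: add.assoc)
    qed
  qed
qed

text \<open>
  The last premise says that \<open>\<Psi>\<close> at a point is a function of the values \<open>\<Phi> a\<close> there, without
  naming that function. Finiteness of \<open>A\<close> makes the maximum of the ranges of dependence exist.
\<close>

lemma translation_local_combine:
  fixes \<Phi> :: "'k \<Rightarrow> (int \<Rightarrow> 'a) \<Rightarrow> int \<Rightarrow> 'b" and \<Psi> :: "(int \<Rightarrow> 'a) \<Rightarrow> int \<Rightarrow> 'c"
  assumes "finite A"
    and local: "\<And>a. a \<in> A \<Longrightarrow> translation_local (\<Phi> a)"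
    and determined: "\<And>v w i j. (\<And>a. a \<in> A \<Longrightarrow> \<Phi> a v i = \<Phi> a w j) \<Longrightarrow> \<Psi> v i = \<Psi> w j"
  shows "translation_local \<Psi>"
proof -
  have "\<forall>a\<in>A. \<exists>K :: nat. \<forall>v w i j.
      (\<forall>d \<in> {- int K..int K}. v (i + d) = w (j + d)) \<longrightarrow> \<Phi> a v i = \<Phi> a w j"
    using local unfolding translation_local_def by blast
  then obtain K :: "'k \<Rightarrow> nat" where K: "\<And>a v w i j. a \<in> A \<Longrightarrow>
      (\<forall>d \<in> {- int (K a)..int (K a)}. v (i + d) = w (j + d)) \<Longrightarrow> \<Phi> a v i = \<Phi> a w j"
    by metis
  show ?thesis
    unfolding translation_local_def
  proof (intro exI[of _ "\<Sum>a\<in>A. K a"] allI impI)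
    fix v w :: "int \<Rightarrow> 'a" and i j :: int
    assume eq: "\<forall>d \<in> {- int (\<Sum>a\<in>A. K a)..int (\<Sum>a\<in>A. K a)}. v (i + d) = w (j + d)"
    show "\<Psi> v i = \<Psi> w j"
    proof (rule determined, rule K)
      fix a assume a: "a \<in> A"
      have "K a \<le> (\<Sum>a\<in>A. K a)"
        using a \<open>finite A\<close> by (intro member_le_sum) auto
      then have "int (K a) \<le> int (\<Sum>a\<in>A. K a)"
        by (simp only: of_nat_le_iff)
      then show "\<forall>d \<in> {- int (K a)..int (K a)}. v (i + d) = w (j + d)"
        using eq by auto
    qed
  qed
qed

lemma translation_local_map:
  assumes "translation_local \<Phi>"
  shows "translation_local (\<lambda>v i. g (\<Phi> v i))"
  by (rule translation_local_combine[of "{()}" "\<lambda>_. \<Phi>"])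
    (simp_all add: assms)

lemma translation_local_sum:
  fixes \<Phi> :: "'k \<Rightarrow> (int \<Rightarrow> 'a) \<Rightarrow> int \<Rightarrow> 'b::comm_monoid_add"
  assumes "finite A" and "\<And>a. a \<in> A \<Longrightarrow> translation_local (\<Phi> a)"
  shows "translation_local (\<lambda>v i. \<Sum>a\<in>A. \<Phi> a v i)"
proof (rule translation_local_combine[of A \<Phi>])
  fix v w :: "int \<Rightarrow> 'a" and i j :: int
  assume "\<And>a. a \<in> A \<Longrightarrow> \<Phi> a v i = \<Phi> a w j"
  then show "(\<Sum>a\<in>A. \<Phi> a v i) = (\<Sum>a\<in>A. \<Phi> a w j)"
    by (rule sum.cong[OF refl])
qed (fact assms)+

text \<open>
  The stencil function is the operator itself, evaluated at position \<open>0\<close> on any grid function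
  that carries the given values on \<open>{-K..K}\<close>.
\<close>

lemma translation_local_stencil:
  assumes "translation_local \<Phi>"
  shows "\<exists>(K :: nat) g. \<forall>v i. \<Phi> v i = g (stencil v (i - int K) (i + int K))"
proof -
  obtain K :: nat where K: "\<And>v w i j. (\<forall>d \<in> {- int K..int K}. v (i + d) = w (j + d)) \<Longrightarrow> \<Phi> v i = \<Phi> w j"
    using assms unfolding translation_local_def by blast
  define g where "g xs = \<Phi> (\<lambda>d. xs ! nat (d + int K)) 0" for xs
  have "\<Phi> v i = g (stencil v (i - int K) (i + int K))" for v i
    unfolding g_def by (rule K) (auto simp: stencil_def algebra_simps)
  then show ?thesis by blast
qed

section \<open>Centered differences as backward differences\<close>

text \<open>A discrete antiderivative of the difference operator, obtained by summation by parts.\<close>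

definition fd_primitive :: "nat \<Rightarrow> nat \<Rightarrow> (int \<Rightarrow> 'a::real_vector) \<Rightarrow> int \<Rightarrow> 'a" where
  "fd_primitive p q w i =
     (\<Sum>l = - int (fd_radius p q)..int (fd_radius p q).
        fd_coeff p q l *\<^sub>R (\<Sum>j = 1 - int (fd_radius p q)..l. w (i + j)))"

lemma fd_coeff_sum_zero:
  assumes "p \<ge> 1" and "q \<ge> 1"
  shows "(\<Sum>l = - int (fd_radius p q)..int (fd_radius p q). fd_coeff p q l) = 0"
proof -
  have "fd_system p q (fd_coeff p q)"
    unfolding fd_coeff_def by (rule theI'[OF fd_system_unique_existence[OF assms]])
  then have "\<forall>j \<in> {0..2 * fd_radius p q} - {p}.
      (\<Sum>l = - int (fd_radius p q)..int (fd_radius p q). fd_coeff p q l * of_int l ^ j) = 0"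
    by (simp add: fd_system_def Let_def)
  from bspec[OF this, of 0] show ?thesis
    using assms by simp
qed

lemma sum_backward_difference:
  fixes w :: "int \<Rightarrow> 'a::ab_group_add"
  assumes "a \<le> l"
  shows "(\<Sum>j = a + 1..l. w (i + j)) - (\<Sum>j = a + 1..l. w (i - 1 + j)) = w (i + l) - w (i + a)"
  using assms
proof (induction l rule: int_ge_induct)
  case base
  then show ?case by simp
next
  case (step l)
  then have "{a + 1..l + 1} = insert (l + 1) {a + 1..l}" by auto
  with step show ?case by (simp add: algebra_simps)
qed

text \<open>
  The primitive reproduces the difference operator up to the term
  \<open>(\<Sum>l. fd_coeff p q l) *\<^sub>R w (i - s)\<close> coming from the left end of the stencil of radius \<open>s\<close>,
  and this term vanishes because the weights sum to zero.
\<close>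

lemma fd_diff_conservative:
  assumes "p \<ge> 1" and "q \<ge> 1"
  shows "fd_diff h p q (\<lambda>j. w (i + j)) =
    (1 / h ^ p) *\<^sub>R (fd_primitive p q w i - fd_primitive p q w (i - 1))"
proof -
  define s where "s = int (fd_radius p q)"
  have "fd_primitive p q w i - fd_primitive p q w (i - 1) =
      (\<Sum>l = - s..s. fd_coeff p q l *\<^sub>R
         ((\<Sum>j = - s + 1..l. w (i + j)) - (\<Sum>j = - s + 1..l. w (i - 1 + j))))"
    by (simp add: fd_primitive_def s_def scaleR_diff_right sum_subtractf)
  also have "\<dots> = (\<Sum>l = - s..s. fd_coeff p q l *\<^sub>R (w (i + l) - w (i + - s)))"
    by (intro sum.cong refl arg_cong[where f = "scaleR _"] sum_backward_difference) simp
  also have "\<dots> = (\<Sum>l = - s..s. fd_coeff p q l *\<^sub>R w (i + l)) -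
      (\<Sum>l = - s..s. fd_coeff p q l) *\<^sub>R w (i + - s)"
    by (simp add: scaleR_diff_right sum_subtractf scaleR_sum_left)
  also have "(\<Sum>l = - s..s. fd_coeff p q l) = 0"
    unfolding s_def by (rule fd_coeff_sum_zero[OF assms])
  finally show ?thesis
    by (simp add: fd_diff_def s_def)
qed

lemma translation_local_fd_primitive:
  assumes "translation_local \<Phi>"
  shows "translation_local (\<lambda>v. fd_primitive p q (\<Phi> v))"
  unfolding fd_primitive_def
  by (rule translation_local_sum[OF finite_atLeastAtMost_int]
      translation_local_map[where g = "scaleR _"] translation_local_shift[OF assms])+

lemma translation_local_fd_diff:
  assumes "translation_local \<Phi>"
  shows "translation_local (\<lambda>v i. fd_diff h p q (\<lambda>j. \<Phi> v (i + j)))"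
  unfolding fd_diff_def
  by (rule translation_local_sum[OF finite_atLeastAtMost_int]
      translation_local_map[where g = "scaleR _"] translation_local_shift[OF assms])+

section \<open>Locality of the scheme\<close>

text \<open>
  The spatial differences treat \<open>f_tilde k\<close> as an opaque grid function, so simplification must not
  expand its values into Taylor polynomials.
\<close>

declare f_tilde.simps [simp del]

lemma translation_local_weno_flux:
  "translation_local (weno_flux R fhat)"
proof -
  define r :: int where "r = \<lceil>(real R + 1) / 2\<rceil>"
  show ?thesis
  proof (rule translation_local_combine[of "{- r + 1..r}" "\<lambda>c v i. v (i + c)"])
    show "translation_local (\<lambda>v i. v (i + c))" for c
      by (rule translation_local_shift[OF translation_local_eval])
  next
    fix v w :: "int \<Rightarrow> 'a" and i j :: int
    assume eq: "\<And>c. c \<in> {- r + 1..r} \<Longrightarrow> v (i + c) = w (j + c)"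
    have "stencil v (i - r + 1) (i + r) = stencil w (j - r + 1) (j + r)"
      unfolding stencil_def
    proof (rule nth_equalityI)
      fix n assume "n < length (map v [i - r + 1..i + r])"
      then show "map v [i - r + 1..i + r] ! n = map w [j - r + 1..j + r] ! n"
        using eq[of "- r + 1 + int n"] by (auto simp: algebra_simps)
    qed simp
    then show "weno_flux R fhat v i = weno_flux R fhat w j"
      by (simp add: weno_flux_def r_def Let_def)
  qed simp
qed

text \<open>
  \<open>f_tilde\<close> acts only at a single grid point in space, so its range of dependence is that of the
  \<open>u_tilde l\<close> which enter the Taylor polynomial; the spatial difference is where the range grows.
\<close>

lemma translation_local_f_tilde_if:
  assumes "\<And>l. l \<le> k \<Longrightarrow> translation_local (\<lambda>v. u_tilde R f fhat h \<delta> v l)"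
  shows "translation_local (\<lambda>v. f_tilde R f fhat h \<delta> v k)"
proof (rule translation_local_combine[of "{..k}" "\<lambda>l v. u_tilde R f fhat h \<delta> v l"])
  fix v w :: "int \<Rightarrow> 'a" and i j :: int
  assume eq: "\<And>l. l \<in> {..k} \<Longrightarrow> u_tilde R f fhat h \<delta> v l i = u_tilde R f fhat h \<delta> w l j"
  have "(\<Sum>l\<le>k. (\<rho> ^ l / fact l) *\<^sub>R u_tilde R f fhat h \<delta> v l i) =
      (\<Sum>l\<le>k. (\<rho> ^ l / fact l) *\<^sub>R u_tilde R f fhat h \<delta> w l j)" for \<rho>
    using eq by (intro sum.cong) auto
  then show "f_tilde R f fhat h \<delta> v k i = f_tilde R f fhat h \<delta> w k j"
    by (simp only: f_tilde.simps)
qed (use assms in auto)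

lemma translation_local_u_tilde:
  "translation_local (\<lambda>v. u_tilde R f fhat h \<delta> v k)"
proof (induction k rule: less_induct)
  case (less k)
  consider "k = 0" | "k = Suc 0" | l where "k = Suc (Suc l)"
    by (metis not0_implies_Suc)
  then show ?case
  proof cases
    case 1
    then show ?thesis by (simp add: translation_local_eval)
  next
    case 2
    have "translation_local (\<lambda>v i. weno_flux R fhat v i - weno_flux R fhat v (i - 1))"
    proof (rule translation_local_combine[of "{0, - 1}" "\<lambda>c v i. weno_flux R fhat v (i + c)"])
      fix v w :: "int \<Rightarrow> 'a" and i j :: int
      assume eq: "\<And>c. c \<in> {0, - 1} \<Longrightarrow> weno_flux R fhat v (i + c) = weno_flux R fhat w (j + c)"
      show "weno_flux R fhat v i - weno_flux R fhat v (i - 1) =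
          weno_flux R fhat w j - weno_flux R fhat w (j - 1)"
        using eq[of 0] eq[of "- 1"] by simp
    qed (simp_all add: translation_local_shift[OF translation_local_weno_flux])
    from translation_local_map[OF this, of "\<lambda>x. - ((1 / h) *\<^sub>R x)"] 2 show ?thesis
      by simp
  next
    case 3
    have "translation_local (\<lambda>v. f_tilde R f fhat h \<delta> v (Suc l))"
      using less 3 by (intro translation_local_f_tilde_if) simp
    from translation_local_map[OF translation_local_fd_diff[OF this], of uminus] 3 show ?thesis
      by simp
  qed
qed

section \<open>The numerical flux\<close>

fun correction_flux ::
  "nat \<Rightarrow> ('a::real_vector \<Rightarrow> 'a) \<Rightarrow> ('a list \<Rightarrow> 'a) \<Rightarrow> real \<Rightarrow> real \<Rightarrow> nat \<Rightarrow> (int \<Rightarrow> 'a) \<Rightarrow> int \<Rightarrow> 'a"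
where
  "correction_flux R f fhat h \<delta> 0 v = (\<lambda>_. 0)"
| "correction_flux R f fhat h \<delta> (Suc 0) v = weno_flux R fhat v"
| "correction_flux R f fhat h \<delta> (Suc (Suc k)) v =
     fd_primitive 1 (nat \<lceil>(real R - real (Suc k)) / 2\<rceil>) (f_tilde R f fhat h \<delta> v (Suc k))"

text \<open>
  The bound \<open>l \<le> R\<close> makes the order parameter of the spatial difference at least \<open>1\<close>, as the
  existence of the difference weights requires.
\<close>

lemma u_tilde_eq_flux_difference:
  assumes "1 \<le> l" and "l \<le> R"
  shows "u_tilde R f fhat h \<delta> v l i =
    - ((1 / h) *\<^sub>R (correction_flux R f fhat h \<delta> l v i - correction_flux R f fhat h \<delta> l v (i - 1)))"
proof (cases "l = Suc 0")
  case True
  then show ?thesis by simp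
next
  case False
  then obtain k where l: "l = Suc (Suc k)"
    using False assms(1) by (metis not0_implies_Suc not_one_le_zero)
  have "(real R - real (Suc k)) / 2 > 0"
    using assms l by simp
  then have "nat \<lceil>(real R - real (Suc k)) / 2\<rceil> \<ge> 1"
    by (simp only: zero_less_ceiling[symmetric] zero_less_nat_eq[symmetric] Suc_leI One_nat_def)
  from fd_diff_conservative[OF order_refl this] show ?thesis
    unfolding l by simp
qed

lemma translation_local_correction_flux:
  "translation_local (correction_flux R f fhat h \<delta> l)"
proof -
  consider "l = 0" | "l = Suc 0" | k where "l = Suc (Suc k)"
    by (metis not0_implies_Suc)
  then show ?thesis
  proof cases
    case 1
    then show ?thesis by (auto simp: translation_local_def)
  next
    case 2
    then have "correction_flux R f fhat h \<delta> l = weno_flux R fhat"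
      by (simp add: fun_eq_iff)
    then show ?thesis by (simp add: translation_local_weno_flux)
  next
    case 3
    then have "correction_flux R f fhat h \<delta> l =
        (\<lambda>v. fd_primitive 1 (nat \<lceil>(real R - real (Suc k)) / 2\<rceil>) (f_tilde R f fhat h \<delta> v (Suc k)))"
      by (simp add: fun_eq_iff)
    then show ?thesis
      by (simp only: translation_local_fd_primitive translation_local_f_tilde_if
          translation_local_u_tilde)
  qed
qed

text \<open>
  One power of \<open>\<delta>\<close> is left out of the weights since conservation form has the factor \<open>\<delta> / h\<close> in
  front of the flux difference.
\<close>

definition lw_flux ::
  "nat \<Rightarrow> ('a::real_vector \<Rightarrow> 'a) \<Rightarrow> ('a list \<Rightarrow> 'a) \<Rightarrow> real \<Rightarrow> real \<Rightarrow> (int \<Rightarrow> 'a) \<Rightarrow> int \<Rightarrow> 'a"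
where
  "lw_flux R f fhat h \<delta> v i =
     (\<Sum>l = 1..R. (\<delta> ^ (l - 1) / fact l) *\<^sub>R correction_flux R f fhat h \<delta> l v i)"

lemma translation_local_lw_flux: "translation_local (lw_flux R f fhat h \<delta>)"
  unfolding lw_flux_def
  by (rule translation_local_sum[OF finite_atLeastAtMost]
      translation_local_map[where g = "scaleR _"] translation_local_correction_flux)+

lemma lw_step_conservative:
  "lw_step R f fhat h \<delta> v i =
     v i - (\<delta> / h) *\<^sub>R (lw_flux R f fhat h \<delta> v i - lw_flux R f fhat h \<delta> v (i - 1))"
proof -
  let ?\<Phi> = "\<lambda>l. correction_flux R f fhat h \<delta> l v"
  have "(\<delta> ^ l / fact l) *\<^sub>R u_tilde R f fhat h \<delta> v l i =
      - ((\<delta> / h) *\<^sub>R (\<delta> ^ (l - 1) / fact l) *\<^sub>R (?\<Phi> l i - ?\<Phi> l (i - 1)))"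
    if "l \<in> {1..R}" for l
  proof -
    have "\<delta> ^ l = \<delta> * \<delta> ^ (l - 1)"
      using that by (cases l) auto
    then show ?thesis
      using that by (simp add: u_tilde_eq_flux_difference)
  qed
  then have "(\<Sum>l = 1..R. (\<delta> ^ l / fact l) *\<^sub>R u_tilde R f fhat h \<delta> v l i) =
      - ((\<delta> / h) *\<^sub>R (\<Sum>l = 1..R. (\<delta> ^ (l - 1) / fact l) *\<^sub>R (?\<Phi> l i - ?\<Phi> l (i - 1))))"
    by (simp add: scaleR_sum_right sum_negf)
  then show ?thesis
    by (simp add: lw_step_def lw_flux_def scaleR_diff_right sum_subtractf)
qed

theorem theorem2:
  fixes R :: nat
    and f :: "real ^ 'm \<Rightarrow> real ^ 'm"
    and fhat :: "(real ^ 'm) list \<Rightarrow> real ^ 'm"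
    and h \<delta> :: real
  assumes "R \<ge> 1" and "h > 0" and "\<delta> > 0"
  shows "\<exists>(K :: nat) (ghat :: (real ^ 'm) list \<Rightarrow> real ^ 'm).
    \<forall>u :: nat \<Rightarrow> int \<Rightarrow> real ^ 'm.
      (\<forall>n i. u (Suc n) i = lw_step R f fhat h \<delta> (u n) i) \<longrightarrow>
      (\<forall>n i. u (Suc n) i = u n i - (\<delta> / h) *\<^sub>R
         (ghat (stencil (u n) (i - int K) (i + int K)) -
          ghat (stencil (u n) (i - 1 - int K) (i - 1 + int K))))"
proof -
  obtain K :: nat and ghat where ghat:
    "\<And>v i. lw_flux R f fhat h \<delta> v i = ghat (stencil v (i - int K) (i + int K))"
    using translation_local_stencil[OF translation_local_lw_flux] by blast
  show ?thesis
    by (rule exI[of _ K], rule exI[of _ ghat]) (metis lw_step_conservative ghat)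
qed

end
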